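(* Let $\mathcal{A}$ be a complex Banach algebra with identity $1$ and let $a\in\mathcal{A}$. Then the following are equivalent: (1) $a\in\mathcal{A}^d$, i.e. $a$ has a g-Drazin inverse; (2) there exist an idempotent $e\in\mathcal{A}$, a unit $u\in\mathcal{A}$ and a quasinilpotent $w\in\mathcal{A}$, which commute with each other, such that $a=eu+w$.
   Context: An element $w$ of a Banach algebra $\mathcal{A}$ is quasinilpotent if $\lim_{n\to\infty}\|w^n\|^{1/n}=0$; $\mathcal{A}^{qnil}$ denotes the set of quasinilpotent elements of $\mathcal{A}$. An element $a\in\mathcal{A}$ has a g-Drazin inverse (generalized Drazin inverse) if there exists $b\in\mathcal{A}$ such that $ab=ba$, $b=bab$ and $a-a^2b\in\mathcal{A}^{qnil}$; such $b$ is unique if it exists and is denoted $a^d$. $\mathcal{A}^d$ denotes the set of all elements of $\mathcal{A}$ having a g-Drazin inverse. A unit is a (two-sided) invertible element. *)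

theory Defs
  imports "HOL-Analysis.Analysis"
begin

text \<open>
  A complex Banach algebra with identity. HOL-Analysis only has real normed algebras, so the
  complex scalar multiplication is added on top of the real structure, which it extends.
  \<^class>\<open>monoid_mult\<close> provides the identity; it is used instead of
  \<^class>\<open>real_normed_algebra_1\<close> so that neither \<open>norm 1 = 1\<close> nor \<open>1 \<noteq> 0\<close> is imposed.
\<close>

class complex_banach_algebra = real_normed_algebra + monoid_mult + banach +
  fixes scaleC :: "complex \<Rightarrow> 'a \<Rightarrow> 'a"  (infixr \<open>*\<^sub>C\<close> 75)
  assumes scaleC_of_real: "complex_of_real r *\<^sub>C x = r *\<^sub>R x"
    and scaleC_add_right: "c *\<^sub>C (x + y) = c *\<^sub>C x + c *\<^sub>C y"
    and scaleC_add_left: "(c + d) *\<^sub>C x = c *\<^sub>C x + d *\<^sub>C x"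
    and scaleC_scaleC: "c *\<^sub>C (d *\<^sub>C x) = (c * d) *\<^sub>C x"
    and mult_scaleC_left: "(c *\<^sub>C x) * y = c *\<^sub>C (x * y)"
    and mult_scaleC_right: "x * (c *\<^sub>C y) = c *\<^sub>C (x * y)"
    and norm_scaleC: "norm (c *\<^sub>C x) = cmod c * norm x"

instantiation complex :: complex_banach_algebra
begin

definition scaleC_complex :: "complex \<Rightarrow> complex \<Rightarrow> complex"
  where "scaleC_complex c x = c * x"

instance
  by standard (simp_all add: scaleC_complex_def scaleR_conv_of_real algebra_simps norm_mult)

end

definition quasinilpotent :: "'a::complex_banach_algebra \<Rightarrow> bool"
  where "quasinilpotent w \<longleftrightarrow> (\<lambda>n. root n (norm (w ^ n))) \<longlonglongrightarrow> 0"

definition is_g_Drazin_inverse :: "'a::complex_banach_algebra \<Rightarrow> 'a \<Rightarrow> bool"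
  where "is_g_Drazin_inverse a b \<longleftrightarrow>
    a * b = b * a \<and> b = b * a * b \<and> quasinilpotent (a - a\<^sup>2 * b)"

definition g_Drazin_invertibles :: "'a::complex_banach_algebra set"
  where "g_Drazin_invertibles = {a. \<exists>b. is_g_Drazin_inverse a b}"

text \<open>Two-sided; the library's \<open>is_unit\<close> is only available for commutative rings.\<close>

definition invertible_elem :: "'a::complex_banach_algebra \<Rightarrow> bool"
  where "invertible_elem u \<longleftrightarrow> (\<exists>v. u * v = 1 \<and> v * u = 1)"

definition idempotent_elem :: "'a::complex_banach_algebra \<Rightarrow> bool"
  where "idempotent_elem e \<longleftrightarrow> e * e = e"

end

theory Submission
  imports Defs
begin

text \<open>
  Given a g-Drazin inverse \<open>b\<close> of \<open>a\<close>, the element \<open>e = a b\<close> is idempotent and \<open>a e + (1 - e)\<close>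
  is a unit with inverse \<open>b + (1 - e)\<close>. Conversely, if \<open>a = e u + w\<close>, then \<open>u + w\<close> is a unit by
  the Neumann series, as \<open>w\<close> is quasinilpotent and commutes with \<open>u\<close>; the g-Drazin inverse is
  \<open>e (u + w)\<^sup>-\<^sup>1\<close>, with \<open>a - a\<^sup>2 b = (1 - e) w\<close>.
\<close>

text \<open>
  The exponent must be positive: \<open>norm 1 \<le> 1\<close> is not available here.
\<close>

lemma norm_power_Suc_le:
  fixes x :: "'a::complex_banach_algebra"
  shows "norm (x ^ Suc n) \<le> norm x ^ Suc n"
proof (induction n)
  case 0
  then show ?case by simp
next
  case (Suc n)
  have "norm (x ^ Suc (Suc n)) \<le> norm x * norm (x ^ Suc n)"
    using norm_mult_ineq[of x "x ^ Suc n"] by simp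
  also have "\<dots> \<le> norm x * norm x ^ Suc n"
    using Suc by (rule mult_left_mono) simp
  finally show ?case by simp
qed

lemma power_mult_commuting:
  fixes x y :: "'a::monoid_mult"
  assumes "x * y = y * x"
  shows "(x * y) ^ n = x ^ n * y ^ n"
proof (induction n)
  case 0
  then show ?case by simp
next
  case (Suc n)
  have "y * x ^ n = x ^ n * y"
    using power_commuting_commutes[OF assms] by simp
  then have "x * (y * (x ^ n * y ^ n)) = x * (x ^ n * (y * y ^ n))"
    by (metis mult.assoc)
  with Suc show ?case by (simp add: mult.assoc)
qed

lemma quasinilpotent_mult_commuting:
  fixes c w :: "'a::complex_banach_algebra"
  assumes w: "quasinilpotent w" and comm: "c * w = w * c"
  shows "quasinilpotent (c * w)"
proof -
  have bound: "root n (norm ((c * w) ^ n)) \<le> norm c * root n (norm (w ^ n))" if "n > 0" for n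
  proof -
    have "norm ((c * w) ^ n) \<le> norm (c ^ n) * norm (w ^ n)"
      by (simp add: power_mult_commuting[OF comm] norm_mult_ineq)
    also have "\<dots> \<le> norm c ^ n * norm (w ^ n)"
      using norm_power_Suc_le[of c "n - 1"] that by (intro mult_right_mono) simp_all
    finally have "root n (norm ((c * w) ^ n)) \<le> root n (norm c ^ n * norm (w ^ n))"
      using that by simp
    then show ?thesis
      using that by (simp add: real_root_mult real_root_power_cancel)
  qed
  have lim: "(\<lambda>n. norm c * root n (norm (w ^ n))) \<longlonglongrightarrow> 0"
    using tendsto_mult_right_zero w unfolding quasinilpotent_def by blast
  show ?thesis
    unfolding quasinilpotent_def
    by (rule tendsto_sandwich[OF _ _ tendsto_const lim])
      (auto intro!: eventually_sequentiallyI[of 1] bound real_root_ge_zero)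
qed

lemma invertible_elem_one_minus_quasinilpotent:
  fixes y :: "'a::complex_banach_algebra"
  assumes "quasinilpotent y"
  shows "invertible_elem (1 - y)"
proof -
  define S where "S = (\<Sum>n. y ^ n)"
  have sm: "summable (\<lambda>n. y ^ n)"
    using assms root_test_convergence[of "\<lambda>n. y ^ n" 0] by (simp add: quasinilpotent_def)
  have "(\<Sum>n. y ^ Suc n) = S - 1"
    using suminf_split_head[OF sm] by (simp add: S_def)
  moreover have "y * S = (\<Sum>n. y ^ Suc n)"
    using suminf_mult[OF sm, of y] by (simp add: S_def)
  moreover have "S * y = (\<Sum>n. y ^ Suc n)"
    using suminf_mult2[OF sm, of y] by (simp add: S_def power_commutes)
  ultimately have "(1 - y) * S = 1" "S * (1 - y) = 1"
    by (simp_all add: algebra_simps)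
  then show ?thesis
    unfolding invertible_elem_def by blast
qed

lemma invertible_elem_mult:
  assumes "invertible_elem x" "invertible_elem y"
  shows "invertible_elem (x * y)"
  using assms unfolding invertible_elem_def by (metis mult.assoc mult_1_left)

lemma inverse_commutes:
  fixes c t v :: "'a::monoid_mult"
  assumes "t * v = 1" "v * t = 1" "c * t = t * c"
  shows "c * v = v * c"
  using assms by (metis mult.assoc mult_1_left mult_1_right)

lemma invertible_elem_add_quasinilpotent:
  fixes u w :: "'a::complex_banach_algebra"
  assumes u: "invertible_elem u" and w: "quasinilpotent w" and comm: "u * w = w * u"
  shows "invertible_elem (u + w)"
proof -
  obtain v where v: "u * v = 1" "v * u = 1"
    using u unfolding invertible_elem_def by blast
  have "w * v = v * w"
    using inverse_commutes[OF v] comm by simp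
  then have "quasinilpotent (- v * w)"
    by (intro quasinilpotent_mult_commuting[OF w]) simp
  then have "invertible_elem (u * (1 - - v * w))"
    by (intro invertible_elem_mult[OF u] invertible_elem_one_minus_quasinilpotent)
  moreover have "u * (1 - - v * w) = u + w"
    using v by (simp add: distrib_left flip: mult.assoc)
  ultimately show ?thesis by simp
qed

lemma g_Drazin_invertible_imp_decomposition:
  fixes a b :: "'a::complex_banach_algebra"
  assumes "is_g_Drazin_inverse a b"
  shows "\<exists>e u w. idempotent_elem e \<and> invertible_elem u \<and> quasinilpotent w \<and>
      e * u = u * e \<and> e * w = w * e \<and> u * w = w * u \<and> a = e * u + w"
proof -
  define e where "e = a * b"
  have ab: "a * b = b * a" and bab: "b * a * b = b" and q: "quasinilpotent (a - a\<^sup>2 * b)"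
    using assms unfolding is_g_Drazin_inverse_def by auto
  have be: "b * e = b"
    using bab by (simp add: e_def mult.assoc)
  have eb: "e * b = b"
    using bab ab by (simp add: e_def)
  have ee: "e * e = e"
    using be by (simp add: e_def mult.assoc)
  have ea: "e * a = a * e"
    by (metis ab e_def mult.assoc)
  have aeb: "a * e * b = e"
    using eb by (simp add: mult.assoc) (simp add: e_def)
  have bae: "b * (a * e) = e"
    using ee by (simp add: e_def flip: ab mult.assoc)
  define u where "u = a * e + (1 - e)"
  define w where "w = a - a * e"
  have "u * (b + (1 - e)) = 1" "(b + (1 - e)) * u = 1"
    using aeb bae be eb ee ea
    by (simp_all add: u_def distrib_left distrib_right left_diff_distrib right_diff_distrib
        mult.assoc) (metis ee mult.assoc)
  then have inv: "invertible_elem u"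
    unfolding invertible_elem_def by blast
  have qw: "quasinilpotent w"
    using q by (simp add: w_def e_def power2_eq_square mult.assoc)
  have eae: "e * (a * e) = a * e"
    using ea ee by (metis mult.assoc)
  have eu: "e * u = a * e" and ue: "u * e = a * e"
    using eae ee by (simp_all add: u_def algebra_simps)
  have ew: "e * w = 0" and we: "w * e = 0"
    using eae ee ea by (simp_all add: w_def algebra_simps)
  have uw: "u * w = w" and wu: "w * u = w"
  proof -
    have "a * e * w = 0"
      using ew by (simp add: mult.assoc)
    moreover have "w * (a * e) = 0"
      using we by (metis ea mult.assoc mult_zero_left)
    ultimately show "u * w = w" "w * u = w"
      using ew we by (simp_all add: u_def algebra_simps)
  qed
  have "a = e * u + w"
    by (simp add: eu w_def)
  with inv qw show ?thesis
    using ee eu ue ew we uw wu unfolding idempotent_elem_def by metis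
qed

lemma decomposition_imp_g_Drazin_invertible:
  fixes e u w :: "'a::complex_banach_algebra"
  assumes e: "idempotent_elem e" and u: "invertible_elem u" and w: "quasinilpotent w"
    and eu: "e * u = u * e" and ew: "e * w = w * e" and uw: "u * w = w * u"
  shows "e * u + w \<in> g_Drazin_invertibles"
proof -
  define a where "a = e * u + w"
  obtain v where v: "(u + w) * v = 1" "v * (u + w) = 1"
    using invertible_elem_add_quasinilpotent[OF u w uw] unfolding invertible_elem_def by blast
  have ee: "e * e = e"
    using e by (simp add: idempotent_elem_def)
  have ev: "e * v = v * e"
    by (rule inverse_commutes[OF v]) (simp add: distrib_left distrib_right eu ew)
  have ae: "a * e = e * (u + w)"
    using ee by (simp add: a_def distrib_left distrib_right ew mult.assoc flip: eu)
      (simp flip: mult.assoc)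
  have ea: "e * a = a * e"
    using ee by (simp add: ae) (simp add: a_def distrib_left flip: mult.assoc)
  have euu: "e * u * u = u * (e * u)" and euw: "e * u * w = w * (e * u)"
    using eu ew uw by (metis mult.assoc)+
  have "a * (u + w) = (u + w) * a"
    by (simp add: a_def distrib_left distrib_right euu euw uw)
  then have av: "a * v = v * a"
    by (rule inverse_commutes[OF v])
  define b where "b = e * v"
  have ab: "a * b = e"
    using v by (simp add: b_def ae mult.assoc flip: mult.assoc[of a])
  have ba: "b * a = e"
    using ab ea ev av by (metis b_def mult.assoc)
  have "b * a * b = b"
    using ba ee by (simp add: b_def flip: mult.assoc)
  moreover have "a - a\<^sup>2 * b = (1 - e) * w"
    using ab by (simp add: power2_eq_square mult.assoc ae) (simp add: a_def algebra_simps)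
  moreover have "quasinilpotent ((1 - e) * w)"
    using ew by (intro quasinilpotent_mult_commuting[OF w]) (simp add: algebra_simps)
  ultimately have "is_g_Drazin_inverse a b"
    using ab ba by (simp add: is_g_Drazin_inverse_def)
  then show ?thesis
    unfolding g_Drazin_invertibles_def a_def by blast
qed

theorem theorem2p5:
  fixes a :: "'a::complex_banach_algebra"
  shows "a \<in> g_Drazin_invertibles \<longleftrightarrow>
    (\<exists>e u w. idempotent_elem e \<and> invertible_elem u \<and> quasinilpotent w \<and>
      e * u = u * e \<and> e * w = w * e \<and> u * w = w * u \<and>
      a = e * u + w)"
  using g_Drazin_invertible_imp_decomposition decomposition_imp_g_Drazin_invertible
  unfolding g_Drazin_invertibles_def by blast

end
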